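(* Let $(X_1,\dots,X_k)$ be a $k$-tuple of random variables having finite moments of all orders. Let $l\ge k$ and let $(X_1^n,\dots,X_k^n)_{n\in\{1,\dots,l\}}$ be a family of $l$ independent and identically distributed $k$-tuples of random variables with the same law as $(X_1,\dots,X_k)$. For $i\in\{1,\dots,k\}$ consider the diagonal $l\times l$ matrix $M_i=\mathrm{Diag}(X_i^1,\dots,X_i^l)$. Then $$\mathrm{cum}_k(X_1,\dots,X_k)=\mathbb E\kappa_{0_k}[M_1,\dots,M_k],$$ and more generally, for any $p\in\mathcal D_k$, $$\mathbb E\kappa_p[M_1,\dots,M_k]=\prod_{b\in p\vee\mathrm{id}_k}\mathrm{cum}_{\#b/2}\big((X_i)_{i\in b\cap\{1,\dots,k\}}\big).$$
   Context: $\mathcal P_k$ is the set of partitions of $\{1,\dots,k,1',\dots,k'\}$; $\mathrm{id}_k=\{\{i,i'\}:1\le i\le k\}$; $0_k=\{\{1,\dots,k,1',\dots,k'\}\}$; $p\vee p'$ is the finest partition coarser than both; $\mathcal D_k$ is the set of $p\in\mathcal P_k$ coarser than (or equal to) $\mathrm{id}_k$. $\mathrm{cum}_n$ is the classical joint cumulant: $\mathbb E[X_1\cdots X_n]=\sum_{\pi}\prod_{b\in\pi}\mathrm{cum}_{\#b}((X_i)_{i\in b})$, sum over partitions $\pi$ of $\{1,\dots,n\}$. For $p\in\mathcal P_k$ and $N\ge1$, $\rho_N(p)\in\mathrm{End}((\mathbb C^N)^{\otimes k})$ is the sum of $E_{i_{1'}}^{i_1}\otimes\dots\otimes E_{i_{k'}}^{i_k}$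 over all $(i_1,\dots,i_k,i_{1'},\dots,i_{k'})\in\{1,\dots,N\}^{2k}$ such that $i_a=i_b$ whenever $a,b$ are in the same block of $p$, where $E_i^j$ sends $e_j$ to $e_i$ and the other basis vectors to $0$. Finite-dimensional ($\mathcal P$-)cumulants: with $N=l\ge k$, the endomorphism $\mathbb E[M_1\otimes\dots\otimes M_k]$ lies in the span of $\{\rho_l(p):p\in\mathcal D_k\}$, which are linearly independent since $l\ge k$; the numbers $\mathbb E\kappa_p[M_1,\dots,M_k]$, $p\in\mathcal D_k$, are the unique coefficients with $\mathbb E[M_1\otimes\dots\otimes M_k]=\sum_{p\in\mathcal D_k}\mathbb E\kappa_p[M_1,\dots,M_k]\,\rho_l(p)$. (The general normalization is $N^{\mathrm{nc}(p\vee\mathrm{id}_k)-\mathrm{nc}(p)}\rho_N(p)$, $\mathrm{nc}$ being the number of blocks, and this power of $N$ is $1$ for $p\in\mathcal D_k$.) *)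

theory Defs
  imports "HOL-Probability.Probability" "HOL-Library.Disjoint_Sets"
begin

text \<open>
  The index set of size \<open>k\<close> is a finite type \<open>'k\<close>, and \<open>{1,\<dots>,N}\<close> is a finite type \<open>'n\<close>; the sizes
  are \<open>CARD('k)\<close> and \<open>CARD('n)\<close>. Both are arbitrary nonzero numbers.
  The doubled set \<open>{1,\<dots>,k,1',\<dots>,k'}\<close> is the type \<open>'k + 'k\<close>, where \<open>Inl i\<close> stands for \<open>i\<close> and
  \<open>Inr i\<close> for \<open>i'\<close>.
\<close>

section \<open>Partitions\<close>

definition partitions_P :: "('k::finite + 'k) set set set" where
  "partitions_P = {p. partition_on UNIV p}"

definition id_part :: "('k::finite + 'k) set set" where
  "id_part = range (\<lambda>i. {Inl i, Inr i})"

definition zero_part :: "('k::finite + 'k) set set" where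
  "zero_part = {UNIV}"

text \<open>\<open>refines UNIV p q\<close> says that \<open>q\<close> is coarser than or equal to \<open>p\<close>.\<close>

definition partitions_D :: "('k::finite + 'k) set set set" where
  "partitions_D = {p \<in> partitions_P. refines UNIV id_part p}"

definition part_join ::
    "('k::finite + 'k) set set \<Rightarrow> ('k + 'k) set set \<Rightarrow> ('k + 'k) set set" where
  "part_join p q = (THE r. refines UNIV p r \<and> refines UNIV q r \<and>
     (\<forall>s. refines UNIV p s \<and> refines UNIV q s \<longrightarrow> refines UNIV r s))"

section \<open>Classical joint cumulants\<close>

text \<open>
  \<open>cum P X b\<close> is the joint cumulant of order \<open>card b\<close> of the family \<open>(X i)\<close>, \<open>i \<in> b\<close>. The
  moment-cumulant formula determines it recursively: the term of the one-block partition \<open>{b}\<close> is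
  isolated. The formula itself is \<open>moment_cumulant\<close> below.
\<close>

function cum :: "'a measure \<Rightarrow> ('i::finite \<Rightarrow> 'a \<Rightarrow> complex) \<Rightarrow> 'i set \<Rightarrow> complex" where
  "cum P X b = integral\<^sup>L P (\<lambda>\<omega>. \<Prod>i\<in>b. X i \<omega>)
     - (\<Sum>\<pi>\<in>{\<pi>. partition_on b \<pi> \<and> \<pi> \<noteq> {b}}. \<Prod>c\<in>\<pi>. cum P X c)"
  by pat_completeness auto

lemma partition_block_psubset:
  assumes "partition_on b \<pi>" "\<pi> \<noteq> {b}" "c \<in> \<pi>"
  shows "c \<subset> b"
proof -
  have sub: "c \<subseteq> b" using assms by (auto simp: partition_on_def)
  moreover have "c \<noteq> b"
  proof
    assume "c = b"
    have "d = b" if "d \<in> \<pi>" for d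
    proof (rule ccontr)
      assume "d \<noteq> b"
      then have "disjnt d b"
        using assms that \<open>c = b\<close> by (auto simp: partition_on_def pairwise_def)
      moreover have "d \<subseteq> b" "d \<noteq> {}" using assms that by (auto simp: partition_on_def)
      ultimately show False by (auto simp: disjnt_def)
    qed
    moreover have "b \<in> \<pi>" using assms(3) \<open>c = b\<close> by simp
    ultimately have "\<pi> = {b}" by blast
    with assms(2) show False by contradiction
  qed
  ultimately show ?thesis by blast
qed

termination cum
  by (relation "Wellfounded.measure (\<lambda>(P, X, b). card b)")
     (auto intro!: psubset_card_mono dest: partition_block_psubset)

declare cum.simps [simp del]

lemma moment_cumulant:
  fixes b :: "'i::finite set"
  assumes "b \<noteq> {}"
  shows "integral\<^sup>L P (\<lambda>\<omega>. \<Prod>i\<in>b. X i \<omega>) = (\<Sum>\<pi> | partition_on b \<pi>. \<Prod>c\<in>\<pi>. cum P X c)"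
proof -
  have "{\<pi>. partition_on b \<pi>} = insert {b} {\<pi>. partition_on b \<pi> \<and> \<pi> \<noteq> {b}}"
    using assms by (auto intro: partition_on_space)
  moreover have "finite {\<pi>. partition_on b \<pi> \<and> \<pi> \<noteq> {b}}"
    by (rule finite_subset[OF _ finitely_many_partition_on[of b]]) auto
  ultimately have "(\<Sum>\<pi> | partition_on b \<pi>. \<Prod>c\<in>\<pi>. cum P X c)
    = cum P X b + (\<Sum>\<pi>\<in>{\<pi>. partition_on b \<pi> \<and> \<pi> \<noteq> {b}}. \<Prod>c\<in>\<pi>. cum P X c)"
    by simp
  also have "\<dots> = integral\<^sup>L P (\<lambda>\<omega>. \<Prod>i\<in>b. X i \<omega>)"
    by (simp add: eq_diff_eq[symmetric] cum.simps[of P X b])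
  finally show ?thesis by (rule sym)
qed

section \<open>Endomorphisms of the tensor power\<close>

text \<open>
  The \<open>k\<close>-th tensor power of \<open>\<complex>\<^sup>N\<close> is \<open>complex ^ ('k \<Rightarrow> 'n)\<close>: its basis vector with index \<open>f\<close> is the
  tensor product of the \<open>e\<^bsub>f i\<^esub>\<close>. Its endomorphisms are the square matrices indexed by \<open>'k \<Rightarrow> 'n\<close>.
\<close>

definition tensor_vec :: "('k::finite \<Rightarrow> complex ^ 'n::finite) \<Rightarrow> complex ^ ('k \<Rightarrow> 'n)" where
  "tensor_vec v = (\<chi> f. \<Prod>i\<in>UNIV. v i $ f i)"

definition tensor_mat ::
    "('k::finite \<Rightarrow> complex ^ 'n::finite ^ 'n) \<Rightarrow> complex ^ ('k \<Rightarrow> 'n) ^ ('k \<Rightarrow> 'n)" where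
  "tensor_mat A = (\<chi> f g. \<Prod>i\<in>UNIV. A i $ f i $ g i)"

lemma tensor_vec_axis: "tensor_vec (\<lambda>i. axis (f i) 1) = axis f 1"
proof -
  have "(\<Prod>i\<in>UNIV. (if g i = f i then 1 else 0 :: complex)) = (if g = f then 1 else 0)" for g
  proof (cases "g = f")
    case False
    then obtain i where "g i \<noteq> f i" by auto
    then have "(\<Prod>i\<in>UNIV. (if g i = f i then 1 else 0 :: complex)) = 0"
      by (intro prod_zero) auto
    with False show ?thesis by simp
  qed simp
  then show ?thesis
    unfolding tensor_vec_def axis_def vec_eq_iff by simp
qed

lemma tensor_mat_mult_tensor_vec:
  "tensor_mat A *v tensor_vec v = tensor_vec (\<lambda>i. A i *v v i)"
proof -
  have "(\<Prod>i\<in>UNIV. \<Sum>j\<in>UNIV. A i $ f i $ j * v i $ j)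
      = (\<Sum>g\<in>UNIV. \<Prod>i\<in>UNIV. A i $ f i $ g i * v i $ g i)" for f
    by (subst prod_sum_PiE) (auto simp: PiE_UNIV_domain)
  then show ?thesis
    by (simp add: tensor_mat_def tensor_vec_def matrix_vector_mult_def vec_eq_iff prod.distrib)
qed

text \<open>\<open>mat_unit i j\<close> is \<open>E\<^sub>i\<^sup>j\<close>.\<close>

definition mat_unit :: "'n::finite \<Rightarrow> 'n \<Rightarrow> complex ^ 'n ^ 'n" where
  "mat_unit i j = (\<chi> a b. if a = i \<and> b = j then 1 else 0)"

lemma mat_unit_axis: "mat_unit i j *v axis m 1 = (if m = j then axis i 1 else 0)"
proof -
  have "(\<Sum>b\<in>UNIV. mat_unit i j $ a $ b * axis m 1 $ b) = mat_unit i j $ a $ m" for a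
  proof -
    have "(\<Sum>b\<in>UNIV. mat_unit i j $ a $ b * axis m 1 $ b)
        = (\<Sum>b\<in>UNIV. if b = m then mat_unit i j $ a $ b else 0)"
      by (intro sum.cong) (simp_all add: axis_def)
    then show ?thesis by simp
  qed
  then have "(mat_unit i j *v axis m 1) $ a = mat_unit i j $ a $ m" for a
    by (simp only: matrix_vector_mult_def vec_lambda_beta)
  then show ?thesis
    by (simp add: vec_eq_iff) (simp add: mat_unit_def axis_def)
qed

text \<open>
  In \<open>rho\<close>, \<open>t\<close> is the family of indices; \<open>t (Inl m)\<close> is \<open>i\<^sub>m\<close> and \<open>t (Inr m)\<close> is the index of \<open>m'\<close>.
\<close>

definition rho :: "('k::finite + 'k) set set \<Rightarrow> complex ^ ('k \<Rightarrow> 'n::finite) ^ ('k \<Rightarrow> 'n)" where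
  "rho p = (\<Sum>t | \<forall>b\<in>p. \<forall>x\<in>b. \<forall>y\<in>b. t x = t y.
     tensor_mat (\<lambda>m. mat_unit (t (Inr m)) (t (Inl m))))"

definition cscale :: "complex \<Rightarrow> complex ^ 'a ^ 'b \<Rightarrow> complex ^ 'a ^ 'b" where
  "cscale c A = (\<chi> i j. c * A $ i $ j)"

definition diag_mat :: "('n \<Rightarrow> complex) \<Rightarrow> complex ^ 'n::finite ^ 'n" where
  "diag_mat d = (\<chi> i j. if i = j then d i else 0)"

section \<open>Finite-dimensional cumulants\<close>

text \<open>
  The coefficients of the expectation of the tensor product in the family \<open>rho p\<close>, \<open>p \<in> partitions_D\<close>.
  They are extended by \<open>0\<close> to all other \<open>p\<close>, so that uniqueness of the coefficients is uniqueness of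
  the function \<open>c\<close>. The description is meaningful only when \<open>CARD('k) \<le> CARD('n)\<close> and the
  expectation is in the span of the family.
\<close>

definition Ekappa ::
    "'a measure \<Rightarrow> ('k::finite \<Rightarrow> 'a \<Rightarrow> complex ^ 'n::finite ^ 'n) \<Rightarrow> ('k + 'k) set set \<Rightarrow> complex" where
  "Ekappa Q M = (THE c. (\<forall>p. p \<notin> partitions_D \<longrightarrow> c p = 0) \<and>
     integral\<^sup>L Q (\<lambda>\<omega>. tensor_mat (\<lambda>i. M i \<omega>)) = (\<Sum>p\<in>partitions_D. cscale (c p) (rho p)))"

end

theory Submission
  imports Defs
begin

text \<open>
  Both sides of the expansion of the mean tensor product are diagonal matrices, so everything is
  decided on the entries \<open>(f, f)\<close>, where \<open>f\<close> assigns a copy \<open>f i\<close> to each \<open>i\<close>.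

  The entry of the mean is the expectation of the product of the \<open>Y (f i)\<close>-coordinates. By
  independence it splits into one moment of \<open>X\<close> for each fibre of \<open>f\<close>, and the moment-cumulant
  formula expands every one of them as a sum over the partitions of the fibre. Choosing a partition
  of every fibre is the same as choosing one partition \<open>\<pi>\<close> of the whole index set on whose blocks
  \<open>f\<close> is constant (\<open>prod_fibres_sum_partitions\<close>). The entry is therefore the sum, over these
  \<open>\<pi>\<close>, of the product of the cumulants of the blocks.

  On the other side, the partitions coarser than \<open>id_part\<close> are exactly the doublings
  \<open>{b <+> b | b. b \<in> \<pi>}\<close> of partitions \<open>\<pi>\<close> of the index set (\<open>bij_betw_double_part\<close>), and the
  matrix \<open>rho\<close> of the doubling of \<open>\<pi>\<close> has the entry 1 at \<open>(f, f)\<close> if \<open>f\<close> is constant on the blocks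
  of \<open>\<pi>\<close>, and 0 otherwise (\<open>rho_double_part_nth\<close>). So the products of cumulants are coefficients
  of an expansion of the mean in the matrices \<open>rho p\<close>.

  These are the only coefficients (\<open>sums_over_constant_partitions_inject\<close>): since there are at least
  as many copies as indices, every partition \<open>\<pi>\<close> is the partition into fibres of some \<open>f\<close>, and the
  entry at that \<open>f\<close> is the sum of the coefficients over all partitions finer than or equal to \<open>\<pi>\<close>.
  Such sums determine the coefficients, by induction along refinement.
\<close>

section \<open>Partitions on which an index function is constant\<close>

definition const_on_blocks :: "('i \<Rightarrow> 'n) \<Rightarrow> 'i set set \<Rightarrow> bool" where
  "const_on_blocks f \<pi> \<longleftrightarrow> (\<forall>b\<in>\<pi>. \<forall>i\<in>b. \<forall>j\<in>b. f i = f j)"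

text \<open>
  Expanding the product of sums chooses a partition of each fibre. The union of these is a partition
  of the whole set, from which they are recovered because a nonempty set lies in at most one fibre.
  An empty fibre has exactly one partition, the empty one, and contributes the factor 1.
\<close>

lemma prod_fibres_sum_partitions:
  fixes f :: "'i::finite \<Rightarrow> 'n::finite" and w :: "'i set \<Rightarrow> 'c::comm_semiring_1"
  shows "(\<Prod>n\<in>UNIV. \<Sum>\<sigma> | partition_on (f -` {n}) \<sigma>. \<Prod>b\<in>\<sigma>. w b)
       = (\<Sum>\<pi> | partition_on UNIV \<pi> \<and> const_on_blocks f \<pi>. \<Prod>b\<in>\<pi>. w b)"
proof -
  let ?S = "PiE UNIV (\<lambda>n. {\<sigma>. partition_on (f -` {n}) \<sigma>})"
  let ?T = "{\<pi>. partition_on UNIV \<pi> \<and> const_on_blocks f \<pi>}"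
  have fib: "b \<subseteq> f -` {n}" "b \<noteq> {}" if "s \<in> ?S" "b \<in> s n" for s b n
  proof -
    have "partition_on (f -` {n}) (s n)" using that(1) by (auto simp: PiE_UNIV_domain)
    from partition_onD1[OF this] partition_onD3[OF this] that(2)
    show "b \<subseteq> f -` {n}" "b \<noteq> {}" by blast+
  qed
  have unique: "m = n" if s: "s \<in> ?S" and b: "b \<in> s m" "b \<subseteq> f -` {n}" for s b m n
  proof -
    obtain i where "i \<in> b" using fib(2)[OF s b(1)] by blast
    with fib(1)[OF s b(1)] b(2) show ?thesis by auto
  qed
  have disj: "s m \<inter> s n = {}" if "s \<in> ?S" "m \<noteq> n" for s m n
    using unique[OF that(1)] fib(1)[OF that(1)] that(2) by blast
  have "(\<Prod>n\<in>UNIV. \<Sum>\<sigma> | partition_on (f -` {n}) \<sigma>. \<Prod>b\<in>\<sigma>. w b)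
      = (\<Sum>s\<in>?S. \<Prod>n\<in>UNIV. \<Prod>b\<in>s n. w b)"
    by (intro prod_sum_PiE) (auto intro: finitely_many_partition_on)
  also have "\<dots> = (\<Sum>\<pi>\<in>?T. \<Prod>b\<in>\<pi>. w b)"
  proof (rule sum.reindex_bij_witness[where
        j = "\<lambda>s. \<Union>n. s n" and i = "\<lambda>\<pi> n. {b \<in> \<pi>. b \<subseteq> f -` {n}}"])
    fix s assume s: "s \<in> ?S"
    show "(\<lambda>n. {b \<in> \<Union>n. s n. b \<subseteq> f -` {n}}) = s"
    proof (intro ext set_eqI iffI)
      fix n b assume "b \<in> {b \<in> \<Union>n. s n. b \<subseteq> f -` {n}}"
      then obtain m where m: "b \<in> s m" "b \<subseteq> f -` {n}" by blast
      with unique[OF s m] show "b \<in> s n" by simp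
    next
      fix n b assume "b \<in> s n"
      with fib[OF s this] show "b \<in> {b \<in> \<Union>n. s n. b \<subseteq> f -` {n}}" by blast
    qed
    have part: "partition_on (f -` {n}) (s n)" for n using s by (auto simp: PiE_UNIV_domain)
    have "partition_on UNIV (\<Union>n. s n)"
    proof (rule partition_onI)
      show "\<Union> (\<Union>n. s n) = UNIV"
      proof (intro equalityI subsetI)
        fix i
        have "i \<in> \<Union> (s (f i))" using partition_onD1[OF part[of "f i"]] by blast
        then show "i \<in> \<Union> (\<Union>n. s n)" by blast
      qed simp
      show "{} \<notin> (\<Union>n. s n)" using partition_onD3[OF part] by blast
      fix p q assume "p \<in> (\<Union>n. s n)" "q \<in> (\<Union>n. s n)" and ne: "p \<noteq> q"
      then obtain m n where mn: "p \<in> s m" "q \<in> s n" by blast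
      show "disjnt p q"
      proof (cases "m = n")
        case True
        with mn ne partition_onD2[OF part[of n]] show ?thesis
          by (auto simp: pairwise_def)
      next
        case False
        with fib(1)[OF s mn(1)] fib(1)[OF s mn(2)] show ?thesis
          by (auto simp: disjnt_iff)
      qed
    qed
    moreover have "const_on_blocks f (\<Union>n. s n)"
      unfolding const_on_blocks_def using fib(1)[OF s] by blast
    ultimately show "(\<Union>n. s n) \<in> ?T" by simp
    show "(\<Prod>b\<in>(\<Union>n. s n). w b) = (\<Prod>n\<in>UNIV. \<Prod>b\<in>s n. w b)"
      by (rule prod.UNION_disjoint) (auto dest: disj[OF s])
  next
    fix \<pi> assume \<pi>: "\<pi> \<in> ?T"
    then have part: "partition_on UNIV \<pi>" and const: "const_on_blocks f \<pi>" by auto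
    have fibre: "b \<subseteq> f -` {f i}" if "b \<in> \<pi>" "i \<in> b" for b i
    proof
      fix j assume "j \<in> b"
      with const that have "f j = f i" unfolding const_on_blocks_def by metis
      then show "j \<in> f -` {f i}" by simp
    qed
    show "(\<Union>n. {b \<in> \<pi>. b \<subseteq> f -` {n}}) = \<pi>"
    proof (intro equalityI subsetI)
      fix b assume b: "b \<in> \<pi>"
      with partition_onD3[OF part] obtain i where "i \<in> b" by fastforce
      with fibre[OF b] b show "b \<in> (\<Union>n. {b \<in> \<pi>. b \<subseteq> f -` {n}})" by blast
    qed simp
    have "partition_on (f -` {n}) {b \<in> \<pi>. b \<subseteq> f -` {n}}" for n
    proof (rule partition_onI)
      show "\<Union> {b \<in> \<pi>. b \<subseteq> f -` {n}} = f -` {n}"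
      proof (intro equalityI subsetI)
        fix i assume i: "i \<in> f -` {n}"
        obtain b where b: "b \<in> \<pi>" "i \<in> b" using partition_onD1[OF part] by blast
        with fibre[OF b] i have "b \<subseteq> f -` {n}" by simp
        with b show "i \<in> \<Union> {b \<in> \<pi>. b \<subseteq> f -` {n}}" by blast
      qed auto
    qed (use part in \<open>auto simp: partition_on_def pairwise_def\<close>)
    then show "(\<lambda>n. {b \<in> \<pi>. b \<subseteq> f -` {n}}) \<in> ?S"
      by (simp add: PiE_UNIV_domain)
  qed
  finally show ?thesis .
qed

text \<open>
  The function \<open>f\<close> takes a different value on every block of \<open>\<pi>\<close>, so its fibres are these blocks.
\<close>

lemma ex_fibres_eq_partition:
  fixes \<pi> :: "'i::finite set set"
  assumes part: "partition_on UNIV \<pi>" and card: "CARD('i) \<le> CARD('n::finite)"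
  obtains f :: "'i \<Rightarrow> 'n::finite"
  where "\<And>\<sigma>. partition_on UNIV \<sigma> \<Longrightarrow> const_on_blocks f \<sigma> \<longleftrightarrow> refines UNIV \<sigma> \<pi>"
proof -
  have ex: "\<exists>b\<in>\<pi>. i \<in> b" for i using partition_onD1[OF part] by blast
  have uniq: "b = c" if "b \<in> \<pi>" "c \<in> \<pi>" "i \<in> b" "i \<in> c" for b c i
    using partition_onD2[OF part] that by (auto simp: disjoint_def)
  define blk where "blk i = (THE b. b \<in> \<pi> \<and> i \<in> b)" for i
  have blk: "blk i \<in> \<pi>" "i \<in> blk i" for i
  proof -
    have "\<exists>!b. b \<in> \<pi> \<and> i \<in> b" using ex uniq by blast
    from theI'[OF this] show "blk i \<in> \<pi>" "i \<in> blk i" by (auto simp: blk_def)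
  qed
  \<comment> \<open>Labelling the blocks by one of their points shows that there are at most as many blocks as
      indices, so that there are enough values to give different blocks different ones.\<close>
  obtain g :: "'i \<Rightarrow> 'n" where g: "inj g"
    using card by (metis card_le_inj finite)
  define f where "f i = g (SOME j. j \<in> blk i)" for i
  have rep: "(SOME j. j \<in> blk i) \<in> blk i" for i
    using blk(2) by (rule someI)
  have f_eq: "f i = f j \<longleftrightarrow> blk i = blk j" for i j
  proof
    assume "f i = f j"
    then have "(SOME j. j \<in> blk i) = (SOME i. i \<in> blk j)"
      using g by (simp add: f_def inj_def)
    with rep[of i] rep[of j] show "blk i = blk j"
      using uniq blk(1) by metis
  qed (simp add: f_def)
  show thesis
  proof
    fix \<sigma> :: "'i set set" assume \<sigma>: "partition_on UNIV \<sigma>"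
    show "const_on_blocks f \<sigma> \<longleftrightarrow> refines UNIV \<sigma> \<pi>"
    proof
      assume c: "const_on_blocks f \<sigma>"
      show "refines UNIV \<sigma> \<pi>" unfolding refines_def
      proof (intro conjI \<sigma> part ballI)
        fix b assume b: "b \<in> \<sigma>"
        with partition_onD3[OF \<sigma>] obtain i where i: "i \<in> b" by fastforce
        with c b have "b \<subseteq> blk i"
          using blk(2) f_eq unfolding const_on_blocks_def by blast
        with blk(1) show "\<exists>c\<in>\<pi>. b \<subseteq> c" by blast
      qed
    next
      assume ref: "refines UNIV \<sigma> \<pi>"
      show "const_on_blocks f \<sigma>" unfolding const_on_blocks_def f_eq
      proof (intro ballI)
        fix b i j assume b: "b \<in> \<sigma>" and ij: "i \<in> b" "j \<in> b"
        with ref obtain c where "c \<in> \<pi>" "b \<subseteq> c" by (auto simp: refines_def)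
        with ij blk uniq show "blk i = blk j" by (metis subsetD)
      qed
    qed
  qed
qed

text \<open>
  For the function \<open>f\<close> whose fibres are the blocks of \<open>\<pi>\<close>, the sum runs over all refinements of
  \<open>\<pi>\<close>. The strict ones have fewer refinements than \<open>\<pi>\<close>, so their terms vanish by induction and only
  the term of \<open>\<pi>\<close> itself is left. This is the uniqueness part of Moebius inversion on the refinement order.
\<close>

lemma sums_over_constant_partitions_inject:
  fixes c :: "'i::finite set set \<Rightarrow> 'c::ab_group_add"
  assumes card: "CARD('i) \<le> CARD('n::finite)"
    and zero: "\<And>f :: 'i \<Rightarrow> 'n::finite. (\<Sum>\<pi> | partition_on UNIV \<pi> \<and> const_on_blocks f \<pi>. c \<pi>) = 0"
    and part: "partition_on UNIV \<pi>"
  shows "c \<pi> = 0"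
  using part
proof (induction "card {\<sigma>. refines UNIV \<sigma> \<pi>}" arbitrary: \<pi> rule: less_induct)
  case (less \<pi>)
  have "c \<sigma> = 0" if \<sigma>: "refines UNIV \<sigma> \<pi>" "\<sigma> \<noteq> \<pi>" for \<sigma>
  proof (rule less.hyps)
    have "{\<tau>. refines UNIV \<tau> \<sigma>} \<subset> {\<tau>. refines UNIV \<tau> \<pi>}"
      using \<sigma> refines_asym refines_trans refines_refl[OF less.prems] by blast
    then show "card {\<tau>. refines UNIV \<tau> \<sigma>} < card {\<tau>. refines UNIV \<tau> \<pi>}"
      by (intro psubset_card_mono) auto
  qed (use \<sigma> in \<open>simp add: refines_def\<close>)
  moreover obtain f :: "'i \<Rightarrow> 'n"
    where f: "\<And>\<sigma>. partition_on UNIV \<sigma> \<Longrightarrow> const_on_blocks f \<sigma> \<longleftrightarrow> refines UNIV \<sigma> \<pi>"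
    using ex_fibres_eq_partition[OF less.prems card] by metis
  have "{\<sigma>. partition_on UNIV \<sigma> \<and> const_on_blocks f \<sigma>} = {\<sigma>. refines UNIV \<sigma> \<pi>}"
    using f by (auto simp: refines_def)
  with zero[of f] have "(\<Sum>\<sigma> | refines UNIV \<sigma> \<pi>. c \<sigma>) = 0" by simp
  ultimately show ?case
    using sum.remove[of "{\<sigma>. refines UNIV \<sigma> \<pi>}" \<pi> c] refines_refl[OF less.prems]
    by simp
qed

section \<open>Partitions coarser than the identity partition\<close>

definition double_part :: "'k set set \<Rightarrow> ('k + 'k) set set" where
  "double_part \<pi> = (\<lambda>b. b <+> b) ` \<pi>"

lemma Inl_vimage_Plus: "{i. Inl i \<in> b <+> c} = b"
  by auto

text \<open>
  A block that meets a pair \<open>{i, i'}\<close> contains all of it, hence is determined by its unprimed points,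
  which are the blocks of a partition of the index set.
\<close>

lemma bij_betw_double_part:
  "bij_betw double_part {\<pi>. partition_on (UNIV :: 'k::finite set) \<pi>} partitions_D"
proof (rule bij_betwI[where g = "\<lambda>p. (\<lambda>b. {i. Inl i \<in> b}) ` p"])
  show "double_part \<in> {\<pi>. partition_on (UNIV :: 'k set) \<pi>} \<rightarrow> partitions_D"
  proof
    fix \<pi> :: "'k set set" assume "\<pi> \<in> {\<pi>. partition_on UNIV \<pi>}"
    then have part: "partition_on UNIV \<pi>" by simp
    have cov: "\<exists>b\<in>\<pi>. i \<in> b" for i using partition_onD1[OF part] by blast
    have p: "partition_on UNIV (double_part \<pi>)"
    proof (rule partition_onI)
      show "\<Union> (double_part \<pi>) = UNIV"
      proof (intro equalityI subsetI)
        fix x :: "'k + 'k" 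
        show "x \<in> \<Union> (double_part \<pi>)"
          using cov[of "case x of Inl i \<Rightarrow> i | Inr i \<Rightarrow> i"]
          by (cases x) (auto simp: double_part_def)
      qed simp
      show "{} \<notin> double_part \<pi>"
        using partition_onD3[OF part] by (auto simp: double_part_def Plus_def)
      show "disjnt p q" if "p \<in> double_part \<pi>" "q \<in> double_part \<pi>" "p \<noteq> q" for p q
        using that partition_onD2[OF part]
        by (auto simp: double_part_def pairwise_def disjnt_iff)
    qed
    have i: "partition_on UNIV (id_part :: ('k + 'k) set set)"
    proof (rule partition_onI)
      show "\<Union> (id_part :: ('k + 'k) set set) = UNIV"
      proof (intro equalityI subsetI)
        fix x :: "'k + 'k"
        show "x \<in> \<Union> id_part" by (cases x) (auto simp: id_part_def)
      qed simp
    qed (auto simp: id_part_def disjnt_def)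
    have "\<exists>d\<in>double_part \<pi>. c \<subseteq> d" if "c \<in> id_part" for c
    proof -
      from that obtain i where "c = {Inl i, Inr i}" by (auto simp: id_part_def)
      moreover obtain b where "b \<in> \<pi>" "i \<in> b" using cov by blast
      ultimately have "b <+> b \<in> double_part \<pi>" "c \<subseteq> b <+> b"
        by (auto simp: double_part_def)
      then show ?thesis by blast
    qed
    with p i show "double_part \<pi> \<in> partitions_D"
      by (simp add: partitions_D_def partitions_P_def refines_def)
  qed
  have sym: "Inl i \<in> b \<longleftrightarrow> Inr i \<in> b" if "p \<in> partitions_D" "b \<in> p" for p b and i :: 'k
  proof -
    have part: "partition_on UNIV p" and ref: "\<forall>c\<in>id_part. \<exists>d\<in>p. c \<subseteq> d"
      using that by (auto simp: partitions_D_def partitions_P_def refines_def)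
    have "{Inl i, Inr i} \<in> id_part" by (simp add: id_part_def)
    from bspec[OF ref this] obtain d where d: "d \<in> p" "Inl i \<in> d" "Inr i \<in> d" by auto
    show ?thesis
    proof (cases "d = b")
      case False
      with disjointD[OF partition_onD2[OF part] d(1) that(2)] have "d \<inter> b = {}" .
      with d(2,3) have "Inl i \<notin> b" "Inr i \<notin> b" by auto
      then show ?thesis by simp
    qed (use d(2,3) in simp)
  qed
  have double: "{i. Inl i \<in> b} <+> {i. Inl i \<in> b} = b"
    if "p \<in> partitions_D" "b \<in> p" for p and b :: "('k + 'k) set"
  proof (rule set_eqI)
    fix x show "x \<in> {i. Inl i \<in> b} <+> {i. Inl i \<in> b} \<longleftrightarrow> x \<in> b"
      using sym[OF that] by (cases x) auto
  qed
  show "double_part ((\<lambda>b. {i. Inl i \<in> b}) ` p) = p" if "p \<in> partitions_D" for p :: "('k + 'k) set set"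
  proof -
    have "(\<lambda>b. {i. Inl i \<in> b} <+> {i. Inl i \<in> b}) ` p = (\<lambda>b. b) ` p"
      using double[OF that] by (rule image_cong[OF refl])
    then show ?thesis unfolding double_part_def image_image by (simp only: image_ident)
  qed
  show "(\<lambda>p. (\<lambda>b. {i. Inl i \<in> b}) ` p) \<in> partitions_D \<rightarrow> {\<pi>. partition_on (UNIV :: 'k set) \<pi>}"
  proof
    fix p :: "('k + 'k) set set" assume pD: "p \<in> partitions_D"
    then have part: "partition_on UNIV p" by (simp add: partitions_D_def partitions_P_def)
    have ne: "{} \<notin> (\<lambda>b. {i. Inl i \<in> b}) ` p"
    proof
      assume "{} \<in> (\<lambda>b. {i. Inl i \<in> b}) ` p"
      then obtain b where b: "{} = {i. Inl i \<in> b}" "b \<in> p" by (rule imageE)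
      have "{i. Inl i \<in> b} <+> {i. Inl i \<in> b} = {}" unfolding b(1)[symmetric] by simp
      with double[OF pD b(2)] b(2) partition_onD3[OF part] show False by simp
    qed
    have "partition_on UNIV ((\<lambda>b. {i. Inl i \<in> b}) ` p)"
      using partition_on_vimage[OF part, of Inl] ne by (simp add: vimage_def)
    then show "(\<lambda>b. {i. Inl i \<in> b}) ` p \<in> {\<pi>. partition_on UNIV \<pi>}" by simp
  qed
  show "(\<lambda>b. {i. Inl i \<in> b}) ` double_part \<pi> = \<pi>" for \<pi> :: "'k set set"
    by (simp add: double_part_def image_image Inl_vimage_Plus)
qed

lemma part_join_id_part:
  assumes "p \<in> partitions_D"
  shows "part_join p id_part = p"
proof -
  have p: "refines UNIV p p" "refines UNIV id_part p"
    using assms by (auto simp: partitions_D_def partitions_P_def intro: refines_refl)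
  show ?thesis unfolding part_join_def
    by (rule the_equality) (use p refines_asym in blast)+
qed

lemma zero_part_in_partitions_D: "(zero_part :: ('k::finite + 'k) set set) \<in> partitions_D"
proof -
  have "double_part {UNIV :: 'k set} = zero_part"
    by (simp add: double_part_def zero_part_def)
  moreover have "partition_on (UNIV :: 'k set) {UNIV}" by (simp add: partition_on_space)
  ultimately show ?thesis
    using bij_betw_apply[OF bij_betw_double_part, of "{UNIV :: 'k set}"] by (metis mem_Collect_eq)
qed

section \<open>Matrix entries\<close>

text \<open>
  The tensor product of matrix units indexed by \<open>t\<close> has a single nonzero entry, whose row is read off
  the primed and whose column off the unprimed values of \<open>t\<close>. So the position \<open>(f, g)\<close> is hit by
  only one \<open>t\<close>, the function \<open>case_sum g f\<close>.
\<close>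

lemma rho_nth:
  "rho p $ f $ g = (if const_on_blocks (case_sum g f) p then 1 else 0)"
proof -
  have unit: "tensor_mat (\<lambda>m. mat_unit (t (Inr m)) (t (Inl m))) $ f $ g
      = (if t = case_sum g f then 1 else 0)" for t :: "'a + 'a \<Rightarrow> 'b"
  proof (cases "t = case_sum g f")
    case False
    then obtain x where "t x \<noteq> case_sum g f x" by blast
    then obtain m where "f m \<noteq> t (Inr m) \<or> g m \<noteq> t (Inl m)"
      by (cases x) fastforce+
    then have "(\<Prod>m\<in>UNIV. mat_unit (t (Inr m)) (t (Inl m)) $ f m $ g m) = 0"
      by (intro prod_zero) (auto simp: mat_unit_def)
    with False show ?thesis by (simp add: tensor_mat_def)
  qed (simp add: tensor_mat_def mat_unit_def)
  have "rho p $ f $ g = (\<Sum>t | const_on_blocks t p. if t = case_sum g f then 1 else 0)"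
    unfolding rho_def const_on_blocks_def sum_component unit ..
  then show ?thesis by simp
qed

text \<open>
  A doubled block contains \<open>i\<close> together with \<open>i'\<close>; this forces \<open>f = g\<close>.
\<close>

lemma rho_double_part_nth:
  assumes "partition_on UNIV \<pi>"
  shows "rho (double_part \<pi>) $ f $ g = (if f = g \<and> const_on_blocks f \<pi> then 1 else 0)"
proof -
  have "const_on_blocks (case_sum g f) (double_part \<pi>) \<longleftrightarrow> f = g \<and> const_on_blocks f \<pi>"
  proof
    assume c: "const_on_blocks (case_sum g f) (double_part \<pi>)"
    have c': "case_sum g f x = case_sum g f y" if "b \<in> \<pi>" "x \<in> b <+> b" "y \<in> b <+> b" for b x y
    proof -
      have "b <+> b \<in> double_part \<pi>" unfolding double_part_def using that(1) by (rule imageI)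
      with c that(2,3) show ?thesis unfolding const_on_blocks_def by metis
    qed
    have "f i = g i" for i
    proof -
      obtain b where "b \<in> \<pi>" "i \<in> b" using partition_onD1[OF assms] by blast
      with c'[of b "Inl i" "Inr i"] show ?thesis by (simp add: InlI InrI)
    qed
    moreover have "const_on_blocks f \<pi>"
      unfolding const_on_blocks_def
    proof (intro ballI)
      fix b i j assume "b \<in> \<pi>" "i \<in> b" "j \<in> b"
      with c'[of b "Inr i" "Inr j"] show "f i = f j" by (simp add: InrI)
    qed
    ultimately show "f = g \<and> const_on_blocks f \<pi>" by blast
  next
    assume r: "f = g \<and> const_on_blocks f \<pi>"
    show "const_on_blocks (case_sum g f) (double_part \<pi>)"
      unfolding const_on_blocks_def
    proof (intro ballI)
      fix c x y assume "c \<in> double_part \<pi>" and xy: "x \<in> c" "y \<in> c"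
      then obtain b where b: "b \<in> \<pi>" "c = b <+> b" by (auto simp: double_part_def)
      have fb: "f i = f j" if "i \<in> b" "j \<in> b" for i j
        using r b(1) that unfolding const_on_blocks_def by blast
      have "\<exists>i\<in>b. case_sum g f z = f i" if "z \<in> c" for z
        using that r by (auto simp: b(2))
      with xy fb show "case_sum g f x = case_sum g f y" by metis
    qed
  qed
  then show ?thesis by (simp add: rho_nth)
qed

lemma sum_rho_nth:
  fixes c :: "('k::finite + 'k) set set \<Rightarrow> complex" and f g :: "'k \<Rightarrow> 'n::finite"
  shows "(\<Sum>p\<in>partitions_D. cscale (c p) (rho p)) $ f $ g
    = (if f = g then \<Sum>\<pi> | partition_on UNIV \<pi> \<and> const_on_blocks f \<pi>. c (double_part \<pi>) else 0)"
proof -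
  have fin: "finite {\<pi>. partition_on (UNIV :: 'k set) \<pi>}"
    by (simp add: finitely_many_partition_on)
  have "(\<Sum>p\<in>partitions_D. cscale (c p) (rho p)) $ f $ g
      = (\<Sum>p\<in>partitions_D. c p * rho p $ f $ g)"
    by (simp add: cscale_def)
  also have "\<dots> = (\<Sum>\<pi> | partition_on UNIV \<pi>. c (double_part \<pi>) * rho (double_part \<pi>) $ f $ g)"
    by (rule sum.reindex_bij_betw[OF bij_betw_double_part, symmetric])
  also have "\<dots> = (\<Sum>\<pi> | partition_on UNIV \<pi>.
      if f = g \<and> const_on_blocks f \<pi> then c (double_part \<pi>) else 0)"
    by (intro sum.cong) (auto simp: rho_double_part_nth)
  also have "\<dots> = (if f = g
      then \<Sum>\<pi> | partition_on UNIV \<pi> \<and> const_on_blocks f \<pi>. c (double_part \<pi>) else 0)"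
    using fin by (simp add: sum.If_cases Collect_conj_eq)
  finally show ?thesis .
qed

text \<open>
  \<open>Ekappa\<close> is a definite description; comparing the entries \<open>(f, f)\<close> of two expansions shows that
  their coefficients agree, which makes any expansion compute it.
\<close>

lemma Ekappa_eqI:
  fixes M :: "'k::finite \<Rightarrow> 'a \<Rightarrow> complex ^ 'n::finite ^ 'n"
  assumes card: "CARD('k) \<le> CARD('n)"
    and expand: "integral\<^sup>L Q (\<lambda>\<omega>. tensor_mat (\<lambda>i. M i \<omega>))
      = (\<Sum>p\<in>partitions_D. cscale (c p) (rho p))"
    and p: "p \<in> partitions_D"
  shows "Ekappa Q M p = c p"
proof -
  \<comment> \<open>Outside \<open>partitions_D\<close> the description asks for the value 0.\<close>
  let ?c = "\<lambda>p. if p \<in> partitions_D then c p else 0"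
  have "Ekappa Q M = ?c" unfolding Ekappa_def
  proof (rule the_equality)
    show "(\<forall>p. p \<notin> partitions_D \<longrightarrow> ?c p = 0) \<and>
      integral\<^sup>L Q (\<lambda>\<omega>. tensor_mat (\<lambda>i. M i \<omega>)) = (\<Sum>p\<in>partitions_D. cscale (?c p) (rho p))"
      by (simp add: expand)
  next
    fix d assume d: "(\<forall>p. p \<notin> partitions_D \<longrightarrow> d p = 0) \<and>
      integral\<^sup>L Q (\<lambda>\<omega>. tensor_mat (\<lambda>i. M i \<omega>)) = (\<Sum>p\<in>partitions_D. cscale (d p) (rho p))"
    then have eq: "(\<Sum>p\<in>partitions_D. cscale (d p) (rho p :: complex ^ ('k \<Rightarrow> 'n) ^ ('k \<Rightarrow> 'n)))
      = (\<Sum>p\<in>partitions_D. cscale (c p) (rho p))" using expand by simp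
    have zero: "(\<Sum>\<pi> | partition_on UNIV \<pi> \<and> const_on_blocks f \<pi>.
        d (double_part \<pi>) - c (double_part \<pi>)) = 0" for f :: "'k \<Rightarrow> 'n"
      using arg_cong[OF eq, of "\<lambda>A. A $ f $ f"] unfolding sum_rho_nth
      by (simp add: sum_subtractf)
    have diff: "d (double_part \<pi>) - c (double_part \<pi>) = 0" if "partition_on UNIV \<pi>" for \<pi>
      using sums_over_constant_partitions_inject[OF card zero that] .
    show "d = ?c"
    proof
      fix q :: "('k + 'k) set set"
      show "d q = ?c q"
      proof (cases "q \<in> partitions_D")
        case True
        then obtain \<pi> where "partition_on UNIV \<pi>" "q = double_part \<pi>"
          using bij_betw_imp_surj_on[OF bij_betw_double_part] by (metis imageE mem_Collect_eq)
        with diff True show ?thesis by simp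
      qed (use d in simp)
    qed
  qed
  with p show ?thesis by simp
qed

lemma tensor_mat_diag_nth:
  "tensor_mat (\<lambda>i. diag_mat (d i)) $ f $ g = (if f = g then \<Prod>i\<in>UNIV. d i (f i) else 0)"
proof (cases "f = g")
  case False
  then obtain i where "f i \<noteq> g i" by blast
  then have "(\<Prod>i\<in>UNIV. diag_mat (d i) $ f i $ g i) = 0"
    by (intro prod_zero) (auto simp: diag_mat_def)
  with False show ?thesis by (simp add: tensor_mat_def)
qed (simp add: tensor_mat_def diag_mat_def)

section \<open>Moments of independent copies\<close>

lemma bounded_linear_axis: "bounded_linear (axis i :: 'v::euclidean_space \<Rightarrow> 'v ^ 'i::finite)"
  by (rule linear_conv_bounded_linear[THEN iffD1], rule linearI)
     (simp_all add: axis_def vec_eq_iff)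

text \<open>
  Both integrability and, below, the value of a vector-valued integral are read off the coordinates.
  Integrability is what allows this: the Bochner integral of a non-integrable function is 0 by
  convention, even if some of its coordinates are integrable with a nonzero integral.
\<close>

lemma integrable_vec:
  fixes h :: "'a \<Rightarrow> 'v::euclidean_space ^ 'i::finite"
  assumes "\<And>i. integrable M (\<lambda>\<omega>. h \<omega> $ i)"
  shows "integrable M h"
proof -
  have "h \<omega> = (\<Sum>i\<in>UNIV. axis i (h \<omega> $ i))" for \<omega>
    by (simp add: vec_eq_iff axis_def)
  moreover have "integrable M (\<lambda>\<omega>. \<Sum>i\<in>UNIV. axis i (h \<omega> $ i))"
    using assms by (intro Bochner_Integration.integrable_sum
        integrable_bounded_linear[OF bounded_linear_axis])
  ultimately show ?thesis by (metis (no_types, lifting) ext)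
qed

lemma integral_vec_nth:
  fixes h :: "'a \<Rightarrow> 'v::euclidean_space ^ 'i::finite"
  assumes "\<And>i. integrable M (\<lambda>\<omega>. h \<omega> $ i)"
  shows "integral\<^sup>L M h $ i = integral\<^sup>L M (\<lambda>\<omega>. h \<omega> $ i)"
proof -
  have h: "integrable M h" using assms by (rule integrable_vec)
  have "bounded_linear (\<lambda>x :: 'v ^ 'i. x $ i)" by (rule bounded_linear_vec_nth)
  from integral_bounded_linear[OF this h] show ?thesis by (rule sym)
qed

text \<open>
  Every factor is at most the largest one, whose power is one of the summands. This elementary bound
  replaces Hoelder's inequality in the proof that mixed moments exist.
\<close>

lemma prod_le_sum_power_card:
  fixes a :: "'i \<Rightarrow> real"
  assumes "finite b" "b \<noteq> {}" "\<And>i. i \<in> b \<Longrightarrow> 0 \<le> a i"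
  shows "(\<Prod>i\<in>b. a i) \<le> (\<Sum>i\<in>b. a i ^ card b)"
proof -
  have "Max (a ` b) \<in> a ` b" using assms by (intro Max_in) auto
  then obtain j where "j \<in> b" "Max (a ` b) = a j" by auto
  with Max_ge[of "a ` b"] assms(1) have j: "j \<in> b" "\<And>i. i \<in> b \<Longrightarrow> a i \<le> a j" by auto
  have "(\<Prod>i\<in>b. a i) \<le> (\<Prod>i\<in>b. a j)" using j assms by (intro prod_mono) auto
  also have "\<dots> = a j ^ card b" by simp
  also have "\<dots> \<le> (\<Sum>i\<in>b. a i ^ card b)"
    using assms j by (intro member_le_sum) auto
  finally show ?thesis .
qed

lemma (in prob_space) integrable_prod_of_moments:
  fixes X :: "'i \<Rightarrow> 'a \<Rightarrow> complex"
  assumes b: "finite b" and meas: "\<And>i. i \<in> b \<Longrightarrow> X i \<in> borel_measurable M"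
    and mom: "\<And>i r. i \<in> b \<Longrightarrow> integrable M (\<lambda>\<omega>. norm (X i \<omega>) ^ r)"
  shows "integrable M (\<lambda>\<omega>. \<Prod>i\<in>b. X i \<omega>)"
proof (cases "b = {}")
  case False
  show ?thesis
  proof (rule Bochner_Integration.integrable_bound)
    show "integrable M (\<lambda>\<omega>. \<Sum>i\<in>b. norm (X i \<omega>) ^ card b)"
      using mom by (intro Bochner_Integration.integrable_sum)
    show "(\<lambda>\<omega>. \<Prod>i\<in>b. X i \<omega>) \<in> borel_measurable M"
      using meas by (intro borel_measurable_prod)
    have "norm (\<Prod>i\<in>b. X i \<omega>) \<le> norm (\<Sum>i\<in>b. norm (X i \<omega>) ^ card b)" for \<omega>
      using prod_le_sum_power_card[OF b False, of "\<lambda>i. norm (X i \<omega>)"]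
      by (simp add: prod_norm[symmetric] sum_nonneg)
    then show "AE \<omega> in M. norm (\<Prod>i\<in>b. X i \<omega>) \<le> norm (\<Sum>i\<in>b. norm (X i \<omega>) ^ card b)"
      by simp
  qed
qed simp

text \<open>
  For the empty set both sides are 1: the total mass on the left, the empty partition on the right.
  Fibres may be empty, so this case occurs.
\<close>

lemma (in prob_space) moment_cumulant_space:
  fixes X :: "'i::finite \<Rightarrow> 'a \<Rightarrow> complex"
  shows "integral\<^sup>L M (\<lambda>\<omega>. \<Prod>i\<in>b. X i \<omega>) = (\<Sum>\<pi> | partition_on b \<pi>. \<Prod>c\<in>\<pi>. cum M X c)"
proof (cases "b = {}")
  case True
  then show ?thesis by (simp add: partition_on_empty prob_space)
qed (rule moment_cumulant)

text \<open>
  Grouping the factors by the copy \<open>n = f i\<close> that they belong to gives a product of functions of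
  the independent vectors \<open>Y n\<close>. The coordinates of a single \<open>Y n\<close> may depend on each other, so
  their mixed moment stays together.
\<close>

lemma integral_prod_iid_copies:
  fixes X :: "'a \<Rightarrow> complex ^ 'k::finite" and Y :: "'n::finite \<Rightarrow> 'b \<Rightarrow> complex ^ 'k"
  assumes P: "prob_space P" and Q: "prob_space Q"
    and X: "X \<in> borel_measurable P"
    and mom: "\<And>i r. integrable P (\<lambda>\<omega>. norm (X \<omega> $ i) ^ r)"
    and indep: "prob_space.indep_vars Q (\<lambda>_. borel) Y UNIV"
    and law: "\<And>n. distr Q borel (Y n) = distr P borel X"
  shows "integrable Q (\<lambda>\<omega>. \<Prod>i\<in>UNIV. Y (f i) \<omega> $ i)" (is ?int)
    and "integral\<^sup>L Q (\<lambda>\<omega>. \<Prod>i\<in>UNIV. Y (f i) \<omega> $ i)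
      = (\<Prod>n\<in>UNIV. integral\<^sup>L P (\<lambda>\<omega>. \<Prod>i\<in>f -` {n}. X \<omega> $ i))" (is ?eq)
proof -
  interpret P: prob_space P by (rule P)
  interpret Q: prob_space Q by (rule Q)
  define h where "h n y = (\<Prod>i\<in>f -` {n}. y $ i)" for n and y :: "complex ^ 'k"
  have nth: "(\<lambda>y :: complex ^ 'k. y $ i) \<in> borel_measurable borel" for i
    by (intro borel_measurable_continuous_onI continuous_intros)
  have h: "h n \<in> borel_measurable borel" for n
    unfolding h_def by (intro borel_measurable_prod nth)
  have Y: "Y n \<in> borel_measurable Q" for n
    using indep by (auto simp: Q.indep_vars_def)
  have int_X: "integrable P (\<lambda>\<omega>. h n (X \<omega>))" for n
    unfolding h_def using measurable_compose[OF X nth] mom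
    by (intro P.integrable_prod_of_moments) auto
  have int_Y: "integrable Q (\<lambda>\<omega>. h n (Y n \<omega>))" for n
    using int_X integrable_distr_eq[OF X h] integrable_distr_eq[OF Y h] law by metis
  have same: "integral\<^sup>L Q (\<lambda>\<omega>. h n (Y n \<omega>)) = integral\<^sup>L P (\<lambda>\<omega>. h n (X \<omega>))" for n
    using integral_distr[OF X h] integral_distr[OF Y h] law by metis
  have ind: "Q.indep_vars (\<lambda>_. borel) (\<lambda>n \<omega>. h n (Y n \<omega>)) UNIV"
    using indep h by (rule Q.indep_vars_compose2)
  have regroup: "(\<Prod>i\<in>UNIV. Y (f i) \<omega> $ i) = (\<Prod>n\<in>UNIV. h n (Y n \<omega>))" for \<omega>
  proof -
    have "(\<Prod>n\<in>UNIV. h n (Y n \<omega>)) = (\<Prod>n\<in>UNIV. \<Prod>i | i \<in> UNIV \<and> f i = n. Y (f i) \<omega> $ i)"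
      unfolding h_def by (intro prod.cong) auto
    also have "\<dots> = (\<Prod>i\<in>UNIV. Y (f i) \<omega> $ i)" by (rule prod.group) auto
    finally show ?thesis by simp
  qed
  show ?int unfolding regroup by (rule Q.indep_vars_integrable[OF _ ind int_Y]) simp
  have "integral\<^sup>L Q (\<lambda>\<omega>. \<Prod>n\<in>UNIV. h n (Y n \<omega>)) = (\<Prod>n\<in>UNIV. integral\<^sup>L Q (\<lambda>\<omega>. h n (Y n \<omega>)))"
    by (rule Q.indep_vars_lebesgue_integral[OF _ ind int_Y]) simp
  then show ?eq unfolding regroup same by (simp add: h_def)
qed

section \<open>Finite-dimensional cumulants of diagonal matrices\<close>

theorem theorem4p6:
  fixes P :: "'a measure"
    and Q :: "'b measure"
    and X :: "'a \<Rightarrow> complex ^ 'k::finite"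
    and Y :: "'n::finite \<Rightarrow> 'b \<Rightarrow> complex ^ 'k"
    and M :: "'k \<Rightarrow> 'b \<Rightarrow> complex ^ 'n ^ 'n"
  assumes "prob_space P"
    and "prob_space Q"
    and "CARD('k) \<le> CARD('n)"
    and "X \<in> borel_measurable P"
    and "\<And>i r. integrable P (\<lambda>\<omega>. norm (X \<omega> $ i) ^ r)"
    and "prob_space.indep_vars Q (\<lambda>_. borel) Y UNIV"
    and "\<And>n. distr Q borel (Y n) = distr P borel X"
    and "\<And>i \<omega>. M i \<omega> = diag_mat (\<lambda>n. Y n \<omega> $ i)"
  shows "cum P (\<lambda>i \<omega>. X \<omega> $ i) UNIV = Ekappa Q M zero_part
    \<and> (\<forall>p\<in>partitions_D. Ekappa Q M p
         = (\<Prod>b\<in>part_join p id_part. cum P (\<lambda>i \<omega>. X \<omega> $ i) {i. Inl i \<in> b}))"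
proof -
  interpret P: prob_space P by fact
  note copies = integral_prod_iid_copies[OF assms(1,2,4,5,6,7)]
  let ?cum = "cum P (\<lambda>i \<omega>. X \<omega> $ i)"
  let ?c = "\<lambda>p :: ('k + 'k) set set. \<Prod>b\<in>p. ?cum {i. Inl i \<in> b}"
  let ?T = "\<lambda>\<omega>. tensor_mat (\<lambda>i. M i \<omega>)"
  have c_double: "?c (double_part \<pi>) = (\<Prod>b\<in>\<pi>. ?cum b)" for \<pi> :: "'k set set"
  proof -
    have "inj_on (\<lambda>b. b <+> b) \<pi>"
      by (rule inj_on_inverseI[where g = "\<lambda>b. {i. Inl i \<in> b}"]) (rule Inl_vimage_Plus)
    then show ?thesis
      by (simp add: double_part_def prod.reindex o_def Inl_vimage_Plus)
  qed
  have entry: "?T \<omega> $ f $ g = (if f = g then \<Prod>i\<in>UNIV. Y (f i) \<omega> $ i else 0)" for \<omega> f g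
    by (simp add: assms(8) tensor_mat_diag_nth)
  have int: "integrable Q (\<lambda>\<omega>. ?T \<omega> $ f $ g)" for f g
    using copies(1)[of f] by (cases "f = g") (simp_all add: entry)
  have "integral\<^sup>L Q ?T $ f $ g = (\<Sum>p\<in>partitions_D. cscale (?c p) (rho p)) $ f $ g" for f g
  proof -
    have "integral\<^sup>L Q ?T $ f $ g = integral\<^sup>L Q (\<lambda>\<omega>. ?T \<omega> $ f $ g)"
      by (subst integral_vec_nth, rule integrable_vec, rule int) (rule integral_vec_nth, rule int)
    also have "\<dots> = (if f = g
        then \<Prod>n\<in>UNIV. integral\<^sup>L P (\<lambda>\<omega>. \<Prod>i\<in>f -` {n}. X \<omega> $ i) else 0)"
      using copies(2)[of f] by (cases "f = g") (simp_all add: entry)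
    also have "\<dots> = (\<Sum>p\<in>partitions_D. cscale (?c p) (rho p)) $ f $ g"
      by (simp only: sum_rho_nth c_double P.moment_cumulant_space prod_fibres_sum_partitions)
    finally show ?thesis .
  qed
  then have expand: "integral\<^sup>L Q ?T = (\<Sum>p\<in>partitions_D. cscale (?c p) (rho p))"
    unfolding vec_eq_iff by (intro allI)
  note Ekappa = Ekappa_eqI[OF assms(3) expand]
  show ?thesis
  proof (intro conjI ballI)
    have "Ekappa Q M zero_part = ?c zero_part" by (rule Ekappa[OF zero_part_in_partitions_D])
    also have "\<dots> = ?cum UNIV" by (simp add: zero_part_def)
    finally show "?cum UNIV = Ekappa Q M zero_part" by (rule sym)
    fix p :: "('k + 'k) set set" assume p: "p \<in> partitions_D"
    show "Ekappa Q M p = (\<Prod>b\<in>part_join p id_part. ?cum {i. Inl i \<in> b})"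
      unfolding part_join_id_part[OF p] by (rule Ekappa[OF p])
  qed
qed

end
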